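(* The approximation ratio $\sum_{i=1}^{D_0}1/i$ is essentially the best possible that can be stated for the greedy algorithm described in the context. This is shown by the following instance of Optimal-Weighted-Lobbying with $n$ referenda $r_1,\ldots,r_n$, $2n+1$ voters $v_1,\ldots,v_{2n+1}$, and target vector $1^n$, where $\epsilon>0$ is a fixed rational constant that can be set arbitrarily small: - for $1\le i\le n$, row $v_i$ has a zero in column $r_i$ and ones in all other columns, and $price(v_i)=1/i$; - row $v_{n+1}$ consists of zeros only, and $price(v_{n+1})=1+\epsilon$; - for $1\le j\le n$, row $v_{n+1+j}$ has a one in column $r_j$ and zeros in all other columns, and $price(v_{n+1+j})=2$. For this instance, each initial deficit is $d_j=1$ ($1\le j\le n$), and hence $D_0=n$. On this input the greedy algorithm sequentially flips, for $i=n,n-1,\ldots,1$, the single zero-entry of voter $v_i$ to a one, so the total money spent is $$1+\frac12+\cdots+\frac1n=1+\frac12+\cdots+\frac1{D_0}.$$ On the other hand, the optimal choice consists of influencing just voter $v_{n+1}$ by flipping all of $v_{n+1}$'s entries to ones, which costs only $1+\epsilon$.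
   Context: **Optimal-Weighted-Lobbying.** An instance (with target vector $1^n$) consists of a matrix $V\in\{0,1\}^{m\times n}$ whose rows $v_1,\ldots,v_m$ represent voters and whose columns $r_1,\ldots,r_n$ represent referenda, and a nonnegative rational price $price(v_i)$ for each voter. A set of voters is feasible if, by changing the entries of the rows of these voters, one can obtain a matrix in which every column has a strict majority of ones. The goal is to find a feasible set of voters with minimum total price; such a set is an optimal choice. **Deficits.** For a column $r_j$ of the (current) matrix, the deficit $d_j\ge 0$ is the minimum number of zeros in that column that need to be flipped to ones so that the column has strictly more ones than zeros. $D_0=\sum_{j=1}^n d_j$ is computed for the initial matrix. **Greedy algorithm.** Input: $V$ and the prices. Initialize $X=\emptyset$, compute all $d_j$, and set $D=\sum_j d_j$. While $D\neq 0$: let $R$ be the set of columns with $d_j=0$; for each row $v_i$ let $\#_0(v_i|_{R^c})$ be the number of zeros of $v_i$ (in the current matrix) in columns not in $R$; choose a voter $v_i$ minimizing $price(v_i)/\#_0(v_i|_{R^c})$ (interpreted as $+\infty$ if $\#_0(v_i|_{R^c})=0$; ties are broken in any simple way, e.g., smallest $i$); flip all zeros of $v_i$ in columns not in $R$ to ones; add $i$ to $X$; decrease $d_j$ by $1$ for each column $r_j$ in which a zero was flipped; recompute $D=\sum_j d_j$. Output $X$. The money spent is $\sum_{i\in X}price(v_i)$. The algorithm is known to have approximation ratio at most $\sum_{i=1}^{D_0}1/i$, i.e., the money it spends is at most this factor times the minimum total price of a feasible set.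
   Formalization: The optimality of influencing just voter v_{n+1} is stated only for n ≥ 2 and ε < 1/2: for n = 1 voter v_1 alone is feasible at price 1 < 1+ε, and for n = 2 with ε > 1/2 voters v_1, v_2 are cheaper. *)

theory Defs
  imports Complex_Main "HOL-Library.Extended" "HOL-Library.While_Combinator"
begin

text \<open>Voters are numbered \<open>1, \<dots>, m\<close> and referenda \<open>1, \<dots>, n\<close>; the entry of a 0/1 matrix in row \<open>i\<close> and
  column \<open>j\<close> is a Boolean, \<open>True\<close> standing for 1. Entries outside these ranges are irrelevant.\<close>

type_synonym vote_matrix = "nat \<Rightarrow> nat \<Rightarrow> bool"

record lobbying =
  nvoters :: nat
  nrefs :: nat
  votes :: vote_matrix
  price :: "nat \<Rightarrow> rat"

definition voters :: "lobbying \<Rightarrow> nat set" where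
  "voters I = {1..nvoters I}"

definition referenda :: "lobbying \<Rightarrow> nat set" where
  "referenda I = {1..nrefs I}"

definition valid_instance :: "lobbying \<Rightarrow> bool" where
  "valid_instance I \<longleftrightarrow> (\<forall>i\<in>voters I. 0 \<le> price I i)"

definition strict_majority :: "lobbying \<Rightarrow> vote_matrix \<Rightarrow> nat \<Rightarrow> bool" where
  "strict_majority I A j \<longleftrightarrow> card {i \<in> voters I. \<not> A i j} < card {i \<in> voters I. A i j}"

definition feasible :: "lobbying \<Rightarrow> nat set \<Rightarrow> bool" where
  "feasible I S \<longleftrightarrow> S \<subseteq> voters I \<and>
    (\<exists>B. (\<forall>i\<in>voters I - S. \<forall>j\<in>referenda I. B i j = votes I i j) \<and>
         (\<forall>j\<in>referenda I. strict_majority I B j))"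

definition total_price :: "lobbying \<Rightarrow> nat set \<Rightarrow> rat" where
  "total_price I S = (\<Sum>i\<in>S. price I i)"

definition optimal :: "lobbying \<Rightarrow> nat set \<Rightarrow> bool" where
  "optimal I S \<longleftrightarrow> feasible I S \<and> (\<forall>T. feasible I T \<longrightarrow> total_price I S \<le> total_price I T)"

definition set_ones :: "vote_matrix \<Rightarrow> (nat \<times> nat) set \<Rightarrow> vote_matrix" where
  "set_ones A F = (\<lambda>i j. A i j \<or> (i, j) \<in> F)"

definition deficit :: "lobbying \<Rightarrow> vote_matrix \<Rightarrow> nat \<Rightarrow> nat" where
  "deficit I A j = (LEAST k. \<exists>F. F \<subseteq> {i \<in> voters I. \<not> A i j} \<and> card F = k \<and>
     strict_majority I (set_ones A (F \<times> {j})) j)"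

definition initial_deficit :: "lobbying \<Rightarrow> nat" where
  "initial_deficit I = (\<Sum>j\<in>referenda I. deficit I (votes I) j)"

record greedy_state =
  cur_votes :: vote_matrix
  cur_deficit :: "nat \<Rightarrow> nat"
  chosen :: "nat set"

definition greedy_init :: "lobbying \<Rightarrow> greedy_state" where
  "greedy_init I = \<lparr>cur_votes = votes I, cur_deficit = deficit I (votes I), chosen = {}\<rparr>"

definition total_deficit :: "lobbying \<Rightarrow> greedy_state \<Rightarrow> nat" where
  "total_deficit I s = (\<Sum>j\<in>referenda I. cur_deficit s j)"

text \<open>The zeros of voter \<open>i\<close> in the columns outside \<open>R\<close>, that is, in the columns of nonzero deficit.\<close>

definition open_zeros :: "lobbying \<Rightarrow> greedy_state \<Rightarrow> nat \<Rightarrow> nat set" where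
  "open_zeros I s i = {j \<in> referenda I. cur_deficit s j \<noteq> 0 \<and> \<not> cur_votes s i j}"

definition price_ratio :: "lobbying \<Rightarrow> greedy_state \<Rightarrow> nat \<Rightarrow> rat extended" where
  "price_ratio I s i =
    (if card (open_zeros I s i) = 0 then Pinf
     else Fin (price I i / of_nat (card (open_zeros I s i))))"

definition best_voters :: "lobbying \<Rightarrow> greedy_state \<Rightarrow> nat set" where
  "best_voters I s = {i \<in> voters I. \<forall>k\<in>voters I. price_ratio I s i \<le> price_ratio I s k}"

text \<open>The algorithm is parametrised by the rule that picks a voter from the set of all minimisers;
  \<open>Min\<close> is the smallest-index rule.\<close>

definition tie_rule :: "(nat set \<Rightarrow> nat) \<Rightarrow> bool" where
  "tie_rule tb \<longleftrightarrow> (\<forall>S. finite S \<and> S \<noteq> {} \<longrightarrow> tb S \<in> S)"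

definition greedy_choice :: "(nat set \<Rightarrow> nat) \<Rightarrow> lobbying \<Rightarrow> greedy_state \<Rightarrow> nat" where
  "greedy_choice tb I s = tb (best_voters I s)"

definition greedy_step :: "(nat set \<Rightarrow> nat) \<Rightarrow> lobbying \<Rightarrow> greedy_state \<Rightarrow> greedy_state" where
  "greedy_step tb I s =
    (let i = greedy_choice tb I s; Z = open_zeros I s i in
     \<lparr>cur_votes = set_ones (cur_votes s) ({i} \<times> Z),
      cur_deficit = (\<lambda>j. if j \<in> Z then cur_deficit s j - 1 else cur_deficit s j),
      chosen = insert i (chosen s)\<rparr>)"

definition greedy :: "(nat set \<Rightarrow> nat) \<Rightarrow> lobbying \<Rightarrow> nat set option" where
  "greedy tb I = map_option chosen
    (while_option (\<lambda>s. total_deficit I s \<noteq> 0) (greedy_step tb I) (greedy_init I))"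

text \<open>\<open>f\<close> is an approximation ratio of the greedy algorithm, stated as a function of the initial
  total deficit.\<close>

definition greedy_approx_ratio :: "(nat set \<Rightarrow> nat) \<Rightarrow> (nat \<Rightarrow> real) \<Rightarrow> bool" where
  "greedy_approx_ratio tb f \<longleftrightarrow>
    (\<forall>I X Y. valid_instance I \<and> greedy tb I = Some X \<and> optimal I Y \<longrightarrow>
       real_of_rat (total_price I X) \<le> f (initial_deficit I) * real_of_rat (total_price I Y))"

definition tight_instance :: "nat \<Rightarrow> rat \<Rightarrow> lobbying" where
  "tight_instance n \<epsilon> =
    \<lparr>nvoters = 2 * n + 1,
     nrefs = n,
     votes = (\<lambda>i j. if i \<le> n then j \<noteq> i else if i = n + 1 then False else i = n + 1 + j),
     price = (\<lambda>i. if i \<le> n then 1 / of_nat i else if i = n + 1 then 1 + \<epsilon> else 2)\<rparr>"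

text \<open>Voter \<open>n + 1\<close> alone is the optimal choice in \<open>tight_instance n \<epsilon>\<close> only if \<open>\<epsilon>\<close> is small, since the voters
  \<open>1, \<dots>, n\<close> form a feasible set of price \<open>1 + 1/2 + \<dots> + 1/n\<close>. This price is 1 for \<open>n = 1\<close>, so no
  \<open>\<epsilon> > 0\<close> is small enough there; for \<open>n \<ge> 2\<close> any \<open>\<epsilon> < 1/2\<close> suffices.\<close>

end

theory Submission
  imports Defs
begin

text \<open>While \<open>m\<close> columns are still deficient, voter \<open>m\<close> repairs one of them at ratio \<open>1/m\<close>. Every voter with
  index above \<open>n\<close> has price above 1 and at most \<open>m\<close> useful zeros, hence a ratio above \<open>1/m\<close>. So the greedy
  algorithm never looks beyond the first \<open>n\<close> voters and takes them in the order \<open>n, \<dots>, 1\<close>. A feasible set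
  avoiding the voters above \<open>n\<close> must be all of \<open>{1..n}\<close>, since \<open>r\<^sub>j\<close> can only be repaired by \<open>v\<^sub>j\<close> there.
  The lower bound on the ratio follows by letting \<open>\<epsilon>\<close> tend to 0 if \<open>d \<ge> 2\<close>; for \<open>d = 1\<close> the optimum is
  \<open>{1}\<close>, at price 1.\<close>

section \<open>Majorities and prices in arbitrary instances\<close>

lemma finite_voters [simp]: "finite (voters I)"
  by (simp add: voters_def)

lemma finite_referenda [simp]: "finite (referenda I)"
  by (simp add: referenda_def)

text \<open>Zeros and ones of a column partition the voters, so counting the ones alone suffices;
  this makes monotonicity immediate.\<close>

lemma strict_majority_iff:
  "strict_majority I A j \<longleftrightarrow> nvoters I < 2 * card {i \<in> voters I. A i j}"
proof -
  have "voters I = {i \<in> voters I. A i j} \<union> {i \<in> voters I. \<not> A i j}" by blast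
  then have "card (voters I) = card {i \<in> voters I. A i j} + card {i \<in> voters I. \<not> A i j}"
    by (subst card_Un_disjoint [symmetric]) auto
  moreover have "card (voters I) = nvoters I" by (simp add: voters_def)
  ultimately show ?thesis unfolding strict_majority_def by linarith
qed

lemma strict_majority_mono:
  assumes "strict_majority I A j" and "\<And>i. i \<in> voters I \<Longrightarrow> A i j \<Longrightarrow> B i j"
  shows "strict_majority I B j"
proof -
  have "card {i \<in> voters I. A i j} \<le> card {i \<in> voters I. B i j}"
    using assms(2) by (intro card_mono) auto
  with assms(1) show ?thesis by (simp add: strict_majority_iff)
qed

text \<open>Serves to rule out proper supersets of \<open>{n + 1}\<close> as optimal
  choices.\<close>

lemma total_price_strict_mono:
  assumes "S \<subset> T" and "T \<subseteq> voters I" and "\<And>i. i \<in> voters I \<Longrightarrow> 0 < price I i"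
  shows "total_price I S < total_price I T"
proof -
  have fin: "finite T" using finite_subset [OF assms(2)] by simp
  from assms(1) obtain i where "i \<in> T - S" by blast
  with fin assms show ?thesis
    unfolding total_price_def by (intro sum_strict_mono2 [of T S i]) (auto intro: less_imp_le)
qed

lemma price_le_total_price:
  assumes "i \<in> S" and "S \<subseteq> voters I" and "valid_instance I"
  shows "price I i \<le> total_price I S"
  unfolding total_price_def using assms finite_subset [OF assms(2)]
  by (intro member_le_sum) (auto simp: valid_instance_def)

section \<open>Entries, prices and deficits of the tight instance\<close>

lemma
  shows voters_tight: "voters (tight_instance n \<epsilon>) = {1..2 * n + 1}"
    and referenda_tight: "referenda (tight_instance n \<epsilon>) = {1..n}"
  by (simp_all add: voters_def referenda_def tight_instance_def)

lemma votes_tight: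
  "votes (tight_instance n \<epsilon>) i j \<longleftrightarrow> (if i \<le> n then j \<noteq> i else if i = n + 1 then False else i = n + 1 + j)"
  by (simp add: tight_instance_def)

lemma price_tight:
  "price (tight_instance n \<epsilon>) i = (if i \<le> n then 1 / of_nat i else if i = n + 1 then 1 + \<epsilon> else 2)"
  by (simp add: tight_instance_def)

lemma price_tight_pos:
  assumes "0 < \<epsilon>" and "i \<in> voters (tight_instance n \<epsilon>)"
  shows "0 < price (tight_instance n \<epsilon>) i"
  using assms by (auto simp: price_tight voters_tight)

lemma valid_tight: "0 < \<epsilon> \<Longrightarrow> valid_instance (tight_instance n \<epsilon>)"
  by (auto simp: valid_instance_def intro: less_imp_le price_tight_pos)

lemma ones_tight:
  assumes "j \<in> {1..n}"
  shows "{i \<in> voters (tight_instance n \<epsilon>). votes (tight_instance n \<epsilon>) i j} = insert (n + 1 + j) ({1..n} - {j})"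
  using assms by (auto simp: voters_tight votes_tight split: if_splits)

text \<open>With \<open>2 * n + 1\<close> voters this is exactly one vote short of a strict
  majority.\<close>

lemma card_ones_tight:
  assumes "j \<in> {1..n}"
  shows "card {i \<in> voters (tight_instance n \<epsilon>). votes (tight_instance n \<epsilon>) i j} = n"
  unfolding ones_tight [OF assms] using assms by (subst card_insert_disjoint) auto

lemma not_strict_majority_tight:
  assumes "j \<in> {1..n}"
  shows "\<not> strict_majority (tight_instance n \<epsilon>) (votes (tight_instance n \<epsilon>)) j"
  unfolding strict_majority_iff card_ones_tight [OF assms] by (simp add: tight_instance_def)

text \<open>One flipped zero supplies the missing vote, and further pairs in \<open>F\<close> only
  add ones. Leaving \<open>F\<close> arbitrary covers single flips as well as flips of whole
  rows.\<close>

lemma strict_majority_tight_flip: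
  assumes "j \<in> {1..n}" and "i \<in> voters (tight_instance n \<epsilon>)"
    and "\<not> votes (tight_instance n \<epsilon>) i j" and "(i, j) \<in> F"
  shows "strict_majority (tight_instance n \<epsilon>) (set_ones (votes (tight_instance n \<epsilon>)) F) j"
proof -
  let ?I = "tight_instance n \<epsilon>"
  have "card (insert i {i \<in> voters ?I. votes ?I i j}) \<le> card {i \<in> voters ?I. set_ones (votes ?I) F i j}"
    using assms by (intro card_mono) (auto simp: set_ones_def)
  then have "n < card {i \<in> voters ?I. set_ones (votes ?I) F i j}"
    using assms card_ones_tight [OF assms(1)] by (subst (asm) card_insert_disjoint) auto
  then show ?thesis by (simp add: strict_majority_iff) (simp add: tight_instance_def)
qed

lemma deficit_tight:
  assumes "j \<in> {1..n}"
  shows "deficit (tight_instance n \<epsilon>) (votes (tight_instance n \<epsilon>)) j = 1"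
  unfolding deficit_def
proof (rule Least_equality, goal_cases)
  case 1
  show ?case
    using assms
    \<comment> \<open>Row \<open>n + 1\<close> consists of zeros, so this voter is a witness for
      every column \<open>j\<close> alike.\<close>
    by (intro exI [of _ "{n + 1}"] conjI strict_majority_tight_flip [where i = "n + 1"])
      (auto simp: voters_tight votes_tight)
next
  case (2 k)
  then obtain F where F: "F \<subseteq> voters (tight_instance n \<epsilon>)" "card F = k"
    "strict_majority (tight_instance n \<epsilon>) (set_ones (votes (tight_instance n \<epsilon>)) (F \<times> {j})) j"
    by blast
  \<comment> \<open>Without a flip the column would keep its initial votes, which fall short of a
    majority.\<close>
  have "F \<noteq> {}"
    using F(3) not_strict_majority_tight [OF assms] by (auto simp: set_ones_def)
  then have "card F \<noteq> 0" using finite_subset [OF F(1)] by simp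
  then show ?case using F(2) by simp
qed

lemma initial_deficit_tight: "initial_deficit (tight_instance n \<epsilon>) = n"
  by (simp add: initial_deficit_def referenda_tight deficit_tight)

section \<open>The run of the greedy algorithm\<close>

text \<open>The state of the greedy algorithm after it has chosen the voters \<open>n, \<dots>, m + 1\<close>; the
  votes do not depend on \<open>\<epsilon>\<close>, so 0 is used for it.\<close>

definition tight_state :: "nat \<Rightarrow> nat \<Rightarrow> greedy_state \<Rightarrow> bool" where
  "tight_state n m s \<longleftrightarrow>
    (\<forall>i. \<forall>j\<in>{1..n}. cur_votes s i j \<longleftrightarrow> votes (tight_instance n 0) i j \<or> i = j \<and> m < j) \<and>
    (\<forall>j\<in>{1..n}. cur_deficit s j = (if j \<le> m then 1 else 0)) \<and>
    chosen s = {m<..n}"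

lemma tight_state_init: "tight_state n n (greedy_init (tight_instance n \<epsilon>))"
  by (auto simp: tight_state_def greedy_init_def deficit_tight votes_tight)

lemma total_deficit_tight_state:
  assumes "tight_state n m s" and "m \<le> n"
  shows "total_deficit (tight_instance n \<epsilon>) s = m"
proof -
  have "total_deficit (tight_instance n \<epsilon>) s = (\<Sum>j\<in>{1..n}. if j \<le> m then 1 else 0)"
    using assms(1) by (simp add: total_deficit_def referenda_tight tight_state_def)
  also have "\<dots> = card ({1..n} \<inter> {j. j \<le> m})"
    by (simp add: sum.If_cases)
  also have "{1..n} \<inter> {j. j \<le> m} = {1..m}" using assms(2) by auto
  finally show ?thesis by simp
qed

text \<open>Flips have occurred only in columns above \<open>m\<close>, which are closed, so the
  open zeros are the original zeros in columns \<open>1..m\<close>. The bound is for voters above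
  \<open>n\<close>, the exact value for voters up to \<open>n\<close>.\<close>

lemma open_zeros_tight_state:
  assumes "tight_state n m s" and "m \<le> n"
  shows "open_zeros (tight_instance n \<epsilon>) s i \<subseteq> {1..m}"
    and "i \<in> {1..n} \<Longrightarrow> open_zeros (tight_instance n \<epsilon>) s i = (if i \<le> m then {i} else {})"
proof -
  have "j \<in> open_zeros (tight_instance n \<epsilon>) s i \<longleftrightarrow> j \<in> {1..m} \<and> \<not> votes (tight_instance n 0) i j" for j
  proof (cases "j \<in> {1..n}")
    case True
    then have "cur_deficit s j = (if j \<le> m then 1 else 0)"
      and "cur_votes s i j \<longleftrightarrow> votes (tight_instance n 0) i j \<or> i = j \<and> m < j"
      using assms(1) by (simp_all only: tight_state_def)
    then show ?thesis using True by (auto simp: open_zeros_def referenda_tight)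
  next
    case False
    then show ?thesis using assms(2) by (auto simp: open_zeros_def referenda_tight)
  qed
  then have *: "open_zeros (tight_instance n \<epsilon>) s i = {j \<in> {1..m}. \<not> votes (tight_instance n 0) i j}"
    by blast
  show "open_zeros (tight_instance n \<epsilon>) s i \<subseteq> {1..m}" unfolding * by blast
  show "i \<in> {1..n} \<Longrightarrow> open_zeros (tight_instance n \<epsilon>) s i = (if i \<le> m then {i} else {})"
    unfolding * by (auto simp: votes_tight)
qed

lemma price_ratio_tight_state:
  assumes st: "tight_state n m s" and m: "m \<in> {1..n}" and "0 < \<epsilon>"
    and i: "i \<in> voters (tight_instance n \<epsilon>)" "i \<noteq> m"
  shows "price_ratio (tight_instance n \<epsilon>) s m < price_ratio (tight_instance n \<epsilon>) s i"
proof -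
  let ?I = "tight_instance n \<epsilon>" and ?c = "card (open_zeros (tight_instance n \<epsilon>) s i)"
  have m': "m \<le> n" using m by simp
  have pm: "price_ratio ?I s m = Fin (1 / of_nat m)"
    using m open_zeros_tight_state(2) [OF st m', of m] by (simp add: price_ratio_def price_tight)
  have "1 / of_nat m < price ?I i / of_nat ?c" if "?c \<noteq> 0"
  proof (cases "i \<le> n")
    case True
    then have "i \<in> {1..n}" using i by (simp add: voters_tight)
    \<comment> \<open>Voters \<open>i > m\<close> have no open zero left; for \<open>i < m\<close>
      the ratio \<open>1 / i\<close> exceeds \<open>1 / m\<close>.\<close>
    then have "i \<le> m" "?c = 1"
      using that open_zeros_tight_state(2) [OF st m', of i \<epsilon>] by (auto split: if_splits)
    then show ?thesis using True i by (auto simp: price_tight voters_tight intro!: divide_strict_left_mono)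
  next
    case False
    then have p: "1 < price ?I i" using \<open>0 < \<epsilon>\<close> by (simp add: price_tight)
    have "?c \<le> m"
      using card_mono [OF _ open_zeros_tight_state(1) [OF st m', of \<epsilon> i]] by simp
    then have "1 / of_nat m \<le> (1 :: rat) / of_nat ?c"
      using that by (intro divide_left_mono) auto
    also have "\<dots> < price ?I i / of_nat ?c"
      using p that by (intro divide_strict_right_mono) auto
    finally show ?thesis .
  qed
  \<comment> \<open>In the remaining case \<open>?c = 0\<close> the ratio is \<open>Pinf\<close>,
    above every \<open>Fin\<close> value.\<close>
  then show ?thesis by (simp add: pm) (simp add: price_ratio_def)
qed

text \<open>The strict inequality of ratios makes \<open>m\<close> the unique minimiser, and every
  tie rule picks the element of a singleton.\<close>

lemma greedy_choice_tight_state: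
  assumes "tie_rule tb" and "tight_state n m s" and "m \<in> {1..n}" and "0 < \<epsilon>"
  shows "greedy_choice tb (tight_instance n \<epsilon>) s = m"
proof -
  let ?I = "tight_instance n \<epsilon>"
  note less = price_ratio_tight_state [OF assms(2-4)]
  have m: "m \<in> voters ?I" using assms(3) by (simp add: voters_tight)
  have "best_voters ?I s = {m}"
  proof (intro equalityI subsetI)
    fix i assume "i \<in> best_voters ?I s"
    then have "i \<in> voters ?I" "price_ratio ?I s i \<le> price_ratio ?I s m"
      using m by (auto simp: best_voters_def)
    then show "i \<in> {m}" using less [of i] by fastforce
  next
    fix i assume "i \<in> {m}"
    moreover have "price_ratio ?I s m \<le> price_ratio ?I s k" if "k \<in> voters ?I" for k
      using less [OF that] by (cases "k = m") auto
    ultimately show "i \<in> best_voters ?I s" using m by (simp add: best_voters_def)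
  qed
  then show ?thesis
    using assms(1) [unfolded tie_rule_def, rule_format, of "{m}"] by (simp add: greedy_choice_def)
qed

lemma tight_state_step:
  assumes "tie_rule tb" and st: "tight_state n (Suc m) s" and m: "Suc m \<le> n" and "0 < \<epsilon>"
  shows "tight_state n m (greedy_step tb (tight_instance n \<epsilon>) s)"
proof -
  have "greedy_choice tb (tight_instance n \<epsilon>) s = Suc m"
    using assms by (intro greedy_choice_tight_state) auto
  moreover have "open_zeros (tight_instance n \<epsilon>) s (Suc m) = {Suc m}"
    using open_zeros_tight_state(2) [OF st m, of "Suc m"] m by simp
  ultimately show ?thesis
    using st m by (auto simp: tight_state_def greedy_step_def set_ones_def)
qed

text \<open>Indexed by the number of steps because \<open>while_option\<close> is defined through
  iterates of the loop body; the invariant counts down from \<open>n\<close>.\<close>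

lemma tight_state_iterate:
  assumes "tie_rule tb" and "0 < \<epsilon>" and "k \<le> n"
  shows "tight_state n (n - k) ((greedy_step tb (tight_instance n \<epsilon>) ^^ k) (greedy_init (tight_instance n \<epsilon>)))"
  using assms(3)
proof (induction k)
  case 0
  show ?case by (simp add: tight_state_init)
next
  case (Suc k)
  then have "n - k = Suc (n - Suc k)" by simp
  with Suc show ?case
    using tight_state_step [OF assms(1) _ _ assms(2), of n "n - Suc k"] by simp
qed

text \<open>Each step lowers the total deficit by exactly one, from \<open>n\<close> to 0, so the
  loop stops at iterate \<open>n\<close> and no earlier.\<close>

lemma greedy_tight:
  assumes "tie_rule tb" and "0 < \<epsilon>"
  shows "greedy tb (tight_instance n \<epsilon>) = Some {1..n}"
proof -
  let ?I = "tight_instance n \<epsilon>"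
  let ?s = "\<lambda>k. (greedy_step tb ?I ^^ k) (greedy_init ?I)"
  have td: "total_deficit ?I (?s k) = n - k" if "k \<le> n" for k
    using total_deficit_tight_state [OF tight_state_iterate [OF assms that]] by simp
  have "(LEAST k. \<not> total_deficit ?I (?s k) \<noteq> 0) = n"
  proof (rule Least_equality)
    show "n \<le> k" if "\<not> total_deficit ?I (?s k) \<noteq> 0" for k
      using that td [of k] by (cases "k \<le> n") auto
  qed (simp add: td)
  moreover have "\<exists>k. \<not> total_deficit ?I (?s k) \<noteq> 0"
    using td [of n] by auto
  ultimately have "greedy tb ?I = Some (chosen (?s n))"
    by (simp add: greedy_def while_option_def)
  also have "chosen (?s n) = {1..n}"
    using tight_state_iterate [OF assms order_refl] by (auto simp: tight_state_def)
  finally show ?thesis .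
qed

section \<open>Feasible sets and the optimal choice\<close>

lemma feasible_tight_middle: "feasible (tight_instance n \<epsilon>) {n + 1}"
  unfolding feasible_def
proof (intro conjI exI ballI)
  let ?I = "tight_instance n \<epsilon>"
  show "{n + 1} \<subseteq> voters ?I" by (simp add: voters_tight)
  show "set_ones (votes ?I) ({n + 1} \<times> referenda ?I) i j = votes ?I i j"
    if "i \<in> voters ?I - {n + 1}" for i j
    using that by (simp add: set_ones_def)
  show "strict_majority ?I (set_ones (votes ?I) ({n + 1} \<times> referenda ?I)) j" if "j \<in> referenda ?I" for j
    using that by (intro strict_majority_tight_flip [where i = "n + 1"])
      (auto simp: voters_tight referenda_tight votes_tight)
qed

lemma feasible_tight_low: "feasible (tight_instance n \<epsilon>) {1..n}"
  unfolding feasible_def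
proof (intro conjI exI ballI)
  let ?I = "tight_instance n \<epsilon>"
  show "{1..n} \<subseteq> voters ?I" by (auto simp: voters_tight)
  show "set_ones (votes ?I) ({1..n} \<times> referenda ?I) i j = votes ?I i j"
    if "i \<in> voters ?I - {1..n}" for i j
    using that by (auto simp: set_ones_def)
  show "strict_majority ?I (set_ones (votes ?I) ({1..n} \<times> referenda ?I)) j" if "j \<in> referenda ?I" for j
    using that by (intro strict_majority_tight_flip [where i = j])
      (auto simp: voters_tight referenda_tight votes_tight)
qed

text \<open>If \<open>j\<close> is missing from \<open>S\<close>, all voters of \<open>S\<close>
  already have a one in column \<open>j\<close>, so influencing them cannot add the missing
  vote.\<close>

lemma feasible_tight_low_unique:
  assumes "feasible (tight_instance n \<epsilon>) S" and "S \<subseteq> {1..n}"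
  shows "S = {1..n}"
proof (rule ccontr)
  let ?I = "tight_instance n \<epsilon>"
  assume "S \<noteq> {1..n}"
  then obtain j where j: "j \<in> {1..n}" "j \<notin> S" using assms(2) by blast
  obtain B where B: "\<forall>i\<in>voters ?I - S. \<forall>j\<in>referenda ?I. B i j = votes ?I i j"
    "\<forall>j\<in>referenda ?I. strict_majority ?I B j"
    using assms(1) by (auto simp: feasible_def)
  have "strict_majority ?I (votes ?I) j"
  proof (rule strict_majority_mono)
    show "strict_majority ?I B j" using B(2) j(1) by (simp add: referenda_tight)
    show "votes ?I i j" if "i \<in> voters ?I" "B i j" for i
    proof (cases "i \<in> S")
      case True
      then have "i \<le> n" "i \<noteq> j" using assms(2) j(2) by auto
      then show ?thesis by (simp add: votes_tight)
    next
      case False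
      then show ?thesis using that B(1) j(1) by (auto simp: referenda_tight)
    qed
  qed
  with not_strict_majority_tight [OF j(1)] show False by blast
qed

lemma total_price_tight_low:
  "total_price (tight_instance n \<epsilon>) {1..n} = (\<Sum>i = 1..n. 1 / of_nat i)"
  unfolding total_price_def by (intro sum.cong) (auto simp: price_tight)

lemma total_price_tight_middle: "total_price (tight_instance n \<epsilon>) {n + 1} = 1 + \<epsilon>"
  by (simp add: total_price_def price_tight)

text \<open>A competitor either properly contains \<open>n + 1\<close>, or contains a voter of price
  2, or equals \<open>{1..n}\<close>, whose price is at least \<open>3 / 2\<close>. Strictness
  yields uniqueness of the optimum.\<close>

lemma tight_middle_cheapest:
  assumes "2 \<le> n" and "0 < \<epsilon>" and "\<epsilon> < 1 / 2"
    and S: "feasible (tight_instance n \<epsilon>) S" "S \<noteq> {n + 1}"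
  shows "1 + \<epsilon> < total_price (tight_instance n \<epsilon>) S"
proof -
  let ?I = "tight_instance n \<epsilon>"
  have sub: "S \<subseteq> voters ?I" using S(1) by (simp add: feasible_def)
  consider "n + 1 \<in> S" | i where "i \<in> S" "n + 1 < i" | "S \<subseteq> {1..n}"
  proof (cases "S \<subseteq> {1..n}")
    case False
    then obtain i where "i \<in> S" "i \<notin> {1..n}" by blast
    moreover from this have "n + 1 \<le> i" using sub by (auto simp: voters_tight)
    ultimately show ?thesis using that(1,2) by (cases "i = n + 1") auto
  qed (use that in blast)
  then show ?thesis
  proof cases
    case 1
    then have "{n + 1} \<subset> S" using S(2) by blast
    then have "total_price ?I {n + 1} < total_price ?I S"
      using sub price_tight_pos [OF assms(2)] by (rule total_price_strict_mono)
    then show ?thesis by (simp only: total_price_tight_middle)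
  next
    case 2
    then have "price ?I i \<le> total_price ?I S"
      using sub valid_tight [OF assms(2)] by (intro price_le_total_price)
    with 2 assms(3) show ?thesis by (simp add: price_tight)
  next
    case 3
    \<comment> \<open>The first two harmonic terms give \<open>3 / 2\<close>; here
      \<open>2 \<le> n\<close> enters, and the result matches the bound
      \<open>\<epsilon> < 1 / 2\<close>.\<close>
    have "(\<Sum>i = 1..2. 1 / of_nat i :: rat) \<le> (\<Sum>i = 1..n. 1 / of_nat i)"
      using assms(1) by (intro sum_mono2) auto
    then have "(3 / 2 :: rat) \<le> (\<Sum>i = 1..n. 1 / of_nat i)"
      by (simp add: numeral_2_eq_2)
    also have "\<dots> = total_price ?I S"
      unfolding feasible_tight_low_unique [OF S(1) 3] total_price_tight_low ..
    finally show ?thesis using assms(3) by simp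
  qed
qed

lemma optimal_tight_iff:
  assumes "2 \<le> n" and "0 < \<epsilon>" and "\<epsilon> < 1 / 2"
  shows "optimal (tight_instance n \<epsilon>) S \<longleftrightarrow> S = {n + 1}"
  unfolding optimal_def
  using tight_middle_cheapest [OF assms] feasible_tight_middle [of n \<epsilon>] total_price_tight_middle [of n \<epsilon>]
  by (metis leD less_imp_le order_refl)

text \<open>For \<open>n = 1\<close> every voter costs at least 1, and some voter must be
  influenced.\<close>

lemma optimal_tight_one:
  assumes "0 < \<epsilon>" and "\<epsilon> < 1"
  shows "optimal (tight_instance 1 \<epsilon>) {1}"
  unfolding optimal_def
proof (intro conjI allI impI)
  let ?I = "tight_instance 1 \<epsilon>"
  show "feasible ?I {1}" using feasible_tight_low [of 1 \<epsilon>] by simp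
  fix T assume T: "feasible ?I T"
  then have sub: "T \<subseteq> voters ?I" by (simp add: feasible_def)
  \<comment> \<open>The empty set lies in \<open>{1..1}\<close>, so feasibility would force it to
    equal \<open>{1}\<close>.\<close>
  have "T \<noteq> {}" using feasible_tight_low_unique [OF T] by auto
  then obtain i where i: "i \<in> T" by blast
  have "total_price ?I {1} = 1" by (simp add: total_price_def price_tight)
  also have "1 \<le> price ?I i"
    using i sub assms by (auto simp: price_tight voters_tight le_Suc_eq)
  also have "\<dots> \<le> total_price ?I T"
    using i sub valid_tight [OF assms(1)] by (rule price_le_total_price)
  finally show "total_price ?I {1} \<le> total_price ?I T" .
qed

section \<open>Lower bound for approximation ratios\<close>

text \<open>The optimum \<open>Y\<close> is left open, since \<open>{1}\<close> is used for
  \<open>n = 1\<close> and \<open>{n + 1}\<close> for larger \<open>n\<close>.\<close>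

lemma greedy_approx_ratio_tight:
  assumes "tie_rule tb" and "greedy_approx_ratio tb f" and "0 < \<epsilon>"
    and "optimal (tight_instance n \<epsilon>) Y"
  shows "(\<Sum>i = 1..n. 1 / real i) \<le> f n * real_of_rat (total_price (tight_instance n \<epsilon>) Y)"
proof -
  let ?I = "tight_instance n \<epsilon>"
  have "real_of_rat (total_price ?I {1..n}) \<le> f (initial_deficit ?I) * real_of_rat (total_price ?I Y)"
    using assms valid_tight greedy_tight unfolding greedy_approx_ratio_def by blast
  then show ?thesis
    by (simp only: initial_deficit_tight total_price_tight_low) (simp add: of_rat_sum of_rat_divide)
qed

lemma greedy_approx_ratio_lower_bound:
  assumes "tie_rule tb" and "greedy_approx_ratio tb f" and "1 \<le> d"
  shows "(\<Sum>i = 1..d. 1 / real i) \<le> f d"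
proof (cases "d = 1")
  case True
  have "optimal (tight_instance 1 (1 / 2)) {1}" by (rule optimal_tight_one) auto
  from greedy_approx_ratio_tight [OF assms(1,2) _ this] show ?thesis
    using True by (simp add: total_price_def price_tight)
next
  case False
  then have d: "2 \<le> d" using assms(3) by simp
  let ?H = "\<Sum>i = 1..d. 1 / real i"
  have bound: "?H \<le> f d * (1 + real_of_rat \<epsilon>)" if "0 < \<epsilon>" "\<epsilon> < 1 / 2" for \<epsilon>
    using greedy_approx_ratio_tight [OF assms(1,2) that(1), of d "{d + 1}"]
      optimal_tight_iff [OF d that] total_price_tight_middle [of d \<epsilon>]
    by (simp add: of_rat_add)
  have H: "0 < ?H" using d by (intro sum_pos) auto
  \<comment> \<open>Positivity allows division by \<open>f d\<close>; \<open>1 / 4\<close> is just a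
    value in the admissible range of \<open>\<epsilon>\<close>.\<close>
  have "0 < f d" using bound [of "1 / 4"] H by (simp add: of_rat_divide zero_less_mult_iff)
  show ?thesis
  proof (rule ccontr)
    assume "\<not> ?H \<le> f d"
    \<comment> \<open>The second entry of the minimum is the relative gap between \<open>?H\<close>
      and \<open>f d\<close>: any \<open>\<epsilon>\<close> below it gives
      \<open>f d * (1 + \<epsilon>) < ?H\<close>. Density of the rationals supplies one that can
      serve in a price.\<close>
    with \<open>0 < f d\<close> have "0 < min (1 / 2) (?H / f d - 1)" by simp
    then obtain \<epsilon> where \<epsilon>: "0 < real_of_rat \<epsilon>" "real_of_rat \<epsilon> < min (1 / 2) (?H / f d - 1)"
      using of_rat_dense by blast
    have "real_of_rat \<epsilon> < real_of_rat (1 / 2)" using \<epsilon>(2) by (simp add: of_rat_divide)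
    then have "?H \<le> f d * (1 + real_of_rat \<epsilon>)"
      using \<epsilon>(1) by (intro bound) (simp_all only: of_rat_less zero_less_of_rat_iff)
    moreover have "f d * (1 + real_of_rat \<epsilon>) < ?H"
      using \<epsilon>(2) \<open>0 < f d\<close> by (simp add: field_simps)
    ultimately show False by simp
  qed
qed

theorem mainTheorem3:
  fixes tb :: "nat set \<Rightarrow> nat"
  assumes "tie_rule tb"
  shows "(\<forall>f :: nat \<Rightarrow> real. greedy_approx_ratio tb f \<longrightarrow>
            (\<forall>d\<ge>1. (\<Sum>i = 1..d. 1 / real i) \<le> f d))
       \<and> (\<forall>(n::nat) (\<epsilon>::rat). n \<ge> 1 \<and> \<epsilon> > 0 \<longrightarrow>
            (let I = tight_instance n \<epsilon> in
               valid_instance I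
             \<and> (\<forall>j\<in>referenda I. deficit I (votes I) j = 1)
             \<and> initial_deficit I = n
             \<and> (\<forall>k<n. let s = (greedy_step tb I ^^ k) (greedy_init I) in
                   total_deficit I s \<noteq> 0
                 \<and> greedy_choice tb I s = n - k
                 \<and> {j \<in> referenda I. \<not> cur_votes s (n - k) j} = {n - k}
                 \<and> open_zeros I s (n - k) = {n - k})
             \<and> total_deficit I ((greedy_step tb I ^^ n) (greedy_init I)) = 0
             \<and> greedy tb I = Some {1..n}
             \<and> total_price I {1..n} = (\<Sum>i = 1..n. 1 / of_nat i)
             \<and> (\<forall>j\<in>referenda I. strict_majority I (set_ones (votes I) ({n + 1} \<times> referenda I)) j)
             \<and> feasible I {n + 1}
             \<and> total_price I {n + 1} = 1 + \<epsilon>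
             \<and> (n \<ge> 2 \<and> \<epsilon> < 1 / 2 \<longrightarrow> (\<forall>S. optimal I S \<longleftrightarrow> S = {n + 1}))))"
proof (intro conjI allI impI)
  show "(\<Sum>i = 1..d. 1 / real i) \<le> f d" if "greedy_approx_ratio tb f" "1 \<le> d" for f d
    using assms that by (rule greedy_approx_ratio_lower_bound)
next
  fix n :: nat and \<epsilon> :: rat
  assume "n \<ge> 1 \<and> \<epsilon> > 0"
  then have \<epsilon>: "0 < \<epsilon>" by simp
  let ?I = "tight_instance n \<epsilon>"
  let ?s = "\<lambda>k. (greedy_step tb ?I ^^ k) (greedy_init ?I)"
  have step: "\<forall>k<n. total_deficit ?I (?s k) \<noteq> 0 \<and> greedy_choice tb ?I (?s k) = n - k
      \<and> {j \<in> referenda ?I. \<not> cur_votes (?s k) (n - k) j} = {n - k}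
      \<and> open_zeros ?I (?s k) (n - k) = {n - k}"
  proof (intro allI impI)
    fix k assume "k < n"
    have st: "tight_state n (n - k) (?s k)"
      using assms \<epsilon> \<open>k < n\<close> by (intro tight_state_iterate) auto
    \<comment> \<open>Row \<open>n - k\<close> is still untouched after \<open>k\<close> steps, so
      its original zero is its only one.\<close>
    have "{j \<in> referenda ?I. \<not> cur_votes (?s k) (n - k) j} = {n - k}"
      using st \<open>k < n\<close> by (auto simp: tight_state_def referenda_tight votes_tight)
    then show "total_deficit ?I (?s k) \<noteq> 0 \<and> greedy_choice tb ?I (?s k) = n - k
      \<and> {j \<in> referenda ?I. \<not> cur_votes (?s k) (n - k) j} = {n - k}
      \<and> open_zeros ?I (?s k) (n - k) = {n - k}"
      using total_deficit_tight_state [OF st] greedy_choice_tight_state [OF assms st _ \<epsilon>]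
        open_zeros_tight_state(2) [OF st, of "n - k"] \<open>k < n\<close> by auto
  qed
  have last: "total_deficit ?I (?s n) = 0"
    using total_deficit_tight_state [OF tight_state_iterate [OF assms \<epsilon> order_refl]] by simp
  \<comment> \<open>\<open>feasible\<close> hides its witness matrix; this names it, with all of row
    \<open>n + 1\<close> set to ones.\<close>
  have flip: "\<forall>j\<in>referenda ?I. strict_majority ?I (set_ones (votes ?I) ({n + 1} \<times> referenda ?I)) j"
    by (intro ballI strict_majority_tight_flip [where i = "n + 1"])
      (auto simp: voters_tight referenda_tight votes_tight)
  have deficits: "\<forall>j\<in>referenda ?I. deficit ?I (votes ?I) j = 1"
    by (simp add: referenda_tight deficit_tight)
  have opt: "n \<ge> 2 \<and> \<epsilon> < 1 / 2 \<longrightarrow> (\<forall>S. optimal ?I S \<longleftrightarrow> S = {n + 1})"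
    using optimal_tight_iff [OF _ \<epsilon>] by blast
  show "(let I = tight_instance n \<epsilon> in
       valid_instance I
     \<and> (\<forall>j\<in>referenda I. deficit I (votes I) j = 1)
     \<and> initial_deficit I = n
     \<and> (\<forall>k<n. let s = (greedy_step tb I ^^ k) (greedy_init I) in
           total_deficit I s \<noteq> 0
         \<and> greedy_choice tb I s = n - k
         \<and> {j \<in> referenda I. \<not> cur_votes s (n - k) j} = {n - k}
         \<and> open_zeros I s (n - k) = {n - k})
     \<and> total_deficit I ((greedy_step tb I ^^ n) (greedy_init I)) = 0
     \<and> greedy tb I = Some {1..n}
     \<and> total_price I {1..n} = (\<Sum>i = 1..n. 1 / of_nat i)
     \<and> (\<forall>j\<in>referenda I. strict_majority I (set_ones (votes I) ({n + 1} \<times> referenda I)) j)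
     \<and> feasible I {n + 1}
     \<and> total_price I {n + 1} = 1 + \<epsilon>
     \<and> (n \<ge> 2 \<and> \<epsilon> < 1 / 2 \<longrightarrow> (\<forall>S. optimal I S \<longleftrightarrow> S = {n + 1})))"
    unfolding Let_def
    by (intro conjI valid_tight [OF \<epsilon>] deficits initial_deficit_tight step last greedy_tight [OF assms \<epsilon>]
        total_price_tight_low flip feasible_tight_middle total_price_tight_middle opt)
qed

end
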